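(* For any $n\ge 3$, the book graph $B_n=K_{1,n}\,\Box\,K_2$ satisfies $$Z_q(B_n)=\begin{cases}2 & \text{if } q=0,\\ n & \text{for every integer } q\ge 1.\end{cases}$$
   Context: Graphs are finite, simple and undirected. $\Box$ denotes the Cartesian product of graphs and $K_{1,n}$ is the star with $n$ leaves. Colour change rule (CCR): if a coloured vertex has exactly one uncoloured neighbour, that neighbour becomes coloured. $Z_q$-game ($q\ge 0$ an integer): initially all vertices of $G=(V,E)$ are uncoloured. The player repeatedly applies one of the following until all vertices are coloured: (1) for one token, colour any uncoloured vertex; (2) at no cost, apply the CCR on $G$; (3) if $B$ is the current set of coloured vertices and $W_1,\dots,W_k$ are the vertex sets of the components of $G[V\setminus B]$ with $k\ge q+1$, the player selects at least $q+1$ of the $W_i$'s and announces them to an oracle, the oracle returns a nonempty subset $\{W_{i_1},\dots,W_{i_\ell}\}$ of the selected ones, and at no cost the player can apply the CCR on $G[B\cup W_{i_1}\cup\cdots\cup W_{i_\ell}]$. $Z_q(G)$ is the minimum number of tokens needed to guarantee that all vertices can be coloured regardless of how the oracle responds. *)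

theory Defs
  imports "Graph_Theory.Graph_Theory"
begin

text \<open>
  A finite simple undirected graph is a digraph satisfying the locale \<open>graph\<close> (or
  \<open>pair_graph\<close> if arcs are pairs) of the entry \<open>Graph_Theory\<close>: finite, symmetric,
  without loops and parallel arcs, every edge being represented by its two orientations.
  For such graphs strong components are the connected components, so
  \<open>pre_digraph.sccs_verts\<close> is the set of vertex sets of the components.
\<close>

definition cart_prod ::
    "'a pair_pre_digraph \<Rightarrow> 'b pair_pre_digraph \<Rightarrow> ('a \<times> 'b) pair_pre_digraph"
    (infixr \<open>\<box>\<close> 70) where
  "G \<box> H = \<lparr>
     pverts = pverts G \<times> pverts H,
     parcs = {((u, x), (v, y)) | u x v y.
                (u = v \<and> u \<in> pverts G \<and> (x, y) \<in> parcs H) \<or>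
                ((u, v) \<in> parcs G \<and> x = y \<and> x \<in> pverts H)} \<rparr>"

lemma pair_graph_cart_prod:
  assumes "pair_graph G" "pair_graph H"
  shows "pair_graph (G \<box> H)"
proof -
  interpret G: pair_graph G by fact
  interpret H: pair_graph H by fact
  have sub: "parcs (G \<box> H) \<subseteq> (pverts G \<times> pverts H) \<times> (pverts G \<times> pverts H)"
    using G.in_arcsD1 G.in_arcsD2 H.in_arcsD1 H.in_arcsD2
    by (auto simp: cart_prod_def)
  have fin: "finite (pverts (G \<box> H))" "finite (parcs (G \<box> H))"
    using finite_subset[OF sub] G.pair_finite_verts H.pair_finite_verts
    by (auto simp: cart_prod_def)
  show ?thesis
  proof
    show "symmetric (G \<box> H)"
      using G.arcs_symmetric H.arcs_symmetric
      by (auto simp: symmetric_def sym_def cart_prod_def)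
    show "fst e \<noteq> snd e" if "e \<in> parcs (G \<box> H)" for e
      using that G.no_loops' H.no_loops' by (fastforce simp: cart_prod_def)
  qed (use fin in \<open>auto simp: cart_prod_def dest: G.in_arcsD1 G.in_arcsD2 H.in_arcsD1 H.in_arcsD2\<close>)
qed

text \<open>One application of the colour change rule on \<open>G\<close>; the sets are those of the coloured
  vertices before and after. When \<open>G\<close> is an induced subgraph, only vertices of \<open>G\<close> can
  force or be forced.\<close>

inductive ccr :: "('a, 'b) pre_digraph \<Rightarrow> 'a set \<Rightarrow> 'a set \<Rightarrow> bool" for G where
  ccr: "\<lbrakk>u \<in> B; {v. u \<rightarrow>\<^bsub>G\<^esub> v \<and> v \<notin> B} = {w}\<rbrakk> \<Longrightarrow> ccr G B (insert w B)"

text \<open>\<open>zq_win q G t B\<close>: in the \<open>Z\<^sub>q\<close>-game on \<open>G\<close> with \<open>B\<close> the set of coloured vertices, the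
  player has a strategy that, whatever the opponent answers, colours all vertices in finitely many
  moves while spending at most \<open>t\<close> further tokens. In the rule \<open>announce\<close>, \<open>S\<close> is the announced set
  of components and \<open>R\<close> the answer; knowing \<open>R\<close>, the player applies the colour change rule on
  \<open>G[B \<union> \<Union>R]\<close> any number of times.\<close>

inductive zq_win :: "nat \<Rightarrow> ('a, 'b) pre_digraph \<Rightarrow> nat \<Rightarrow> 'a set \<Rightarrow> bool" for q G where
  finished: "zq_win q G t (verts G)"
| token: "\<lbrakk>v \<in> verts G - B; zq_win q G t (insert v B)\<rbrakk> \<Longrightarrow> zq_win q G (Suc t) B"
| force: "\<lbrakk>ccr G B B'; zq_win q G t B'\<rbrakk> \<Longrightarrow> zq_win q G t B"
| announce: "\<lbrakk>S \<subseteq> pre_digraph.sccs_verts (G \<restriction> (verts G - B)); q + 1 \<le> card S;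
    \<And>R. \<lbrakk>R \<subseteq> S; R \<noteq> {}\<rbrakk> \<Longrightarrow> \<exists>B'. (ccr (G \<restriction> (B \<union> \<Union>R)))\<^sup>*\<^sup>* B B' \<and> zq_win q G t B'\<rbrakk>
    \<Longrightarrow> zq_win q G t B"

definition Zq :: "nat \<Rightarrow> ('a, 'b) pre_digraph \<Rightarrow> nat" where
  "Zq q G = (LEAST t. zq_win q G t {})"

lemma zq_win_card:
  assumes "finite (verts G)" "B \<subseteq> verts G"
  shows "zq_win q G (card (verts G - B)) B"
  using assms(2)
proof (induction "card (verts G - B)" arbitrary: B)
  case 0
  then have "B = verts G" using assms(1) by auto
  then show ?case by (auto intro: zq_win.finished)
next
  case (Suc k)
  then obtain v where v: "v \<in> verts G - B"
    by (metis card.empty equals0I nat.distinct(1))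
  have eq: "verts G - insert v B = verts G - B - {v}" by auto
  have "k = card (verts G - insert v B)"
    using Suc.hyps(2) v assms(1) unfolding eq by simp
  then have "zq_win q G k (insert v B)"
    using Suc.hyps(1)[of "insert v B"] Suc.prems v by auto
  then show ?case
    using zq_win.token[OF v] Suc.hyps(2) by metis
qed

text \<open>For finite graphs the minimum defining \<open>Zq\<close> is attained.\<close>

lemma zq_win_Zq: "finite (verts G) \<Longrightarrow> zq_win q G (Zq q G) {}"
  unfolding Zq_def by (rule LeastI, rule zq_win_card) auto

end

theory Submission
  imports Defs
begin

text \<open>
  Write \<open>c\<close> for the centre of the star, \<open>L\<close> for its leaves and call
  \<open>{l} \<times> {x, y}\<close> with \<open>l \<in> L\<close> a page, untouched if it has no
  coloured vertex. For \<open>q \<ge> 1\<close> the potential (number of untouched pages, minus one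
  as soon as a copy of the centre or a whole page is coloured) drops by at most one per token and
  never drops under the colour change rule. In an announcement the oracle can preserve it as well:
  if the discount has not yet been granted, the uncoloured vertices form a single component and
  nothing can be announced; otherwise it returns everything, except for the component containing the
  only untouched page among the announced ones, if there is exactly one. A centre then never sees
  exactly one untouched page. The potential starts at \<open>card L\<close>. For \<open>q =
  0\<close>, two coloured centres allow the pages to be announced one by one, whereas a single
  coloured vertex forces nothing, because every edge lies in a 4-cycle.
\<close>

section \<open>Colour change rule and components in induced subgraphs\<close>

lemma arcs_ends_induce_with_proj:
  "arcs_ends (with_proj G \<restriction> H) = parcs G \<inter> H \<times> H"
  by (auto simp: arcs_ends_conv intro: rev_image_eqI)

text \<open>Lets facts about the colour change rule on induced subgraphs cover the rule on all of
  \<open>G\<close>.\<close>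

lemma with_proj_induce_pverts:
  assumes "pair_wf_digraph G"
  shows "with_proj G \<restriction> pverts G = with_proj G"
proof -
  interpret pair_wf_digraph G by fact
  have "{e \<in> parcs G. fst e \<in> pverts G \<and> snd e \<in> pverts G} = parcs G"
    using arc_fst_in_verts arc_snd_in_verts by blast
  then show ?thesis by (simp add: with_proj_def induce_subgraph_def)
qed

lemma ccr_with_projI:
  assumes "u \<in> B" "(u, w) \<in> parcs G" "w \<notin> B" "\<And>v. (u, v) \<in> parcs G \<Longrightarrow> v \<notin> B \<Longrightarrow> v = w"
  shows "ccr (with_proj G) B (insert w B)"
proof (rule ccr.ccr)
  show "{v. u \<rightarrow>\<^bsub>with_proj G\<^esub> v \<and> v \<notin> B} = {w}"
    unfolding with_proj_simps using assms(2-4) by blast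
qed (rule assms(1))

lemma ccr_induceI:
  assumes "u \<in> B" "(u, w) \<in> parcs G" "u \<in> H" "w \<in> H" "w \<notin> B"
    and "\<And>v. (u, v) \<in> parcs G \<Longrightarrow> v \<in> H \<Longrightarrow> v \<notin> B \<Longrightarrow> v = w"
  shows "ccr (with_proj G \<restriction> H) B (insert w B)"
proof (rule ccr.ccr)
  show "{v. u \<rightarrow>\<^bsub>with_proj G \<restriction> H\<^esub> v \<and> v \<notin> B} = {w}"
    unfolding arcs_ends_induce_with_proj using assms(2-6) by blast
qed (rule assms(1))

lemma ccr_induceE:
  assumes "ccr (with_proj G \<restriction> H) B B'"
  obtains u w where "u \<in> B" "(u, w) \<in> parcs G" "u \<in> H" "w \<in> H" "w \<notin> B" "B' = insert w B"
    "\<forall>v. (u, v) \<in> parcs G \<longrightarrow> v \<in> H \<longrightarrow> v \<notin> B \<longrightarrow> v = w"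
  using assms
proof cases
  case (ccr u w)
  then have "w \<in> {v. (u, v) \<in> parcs G \<inter> H \<times> H \<and> v \<notin> B}"
    by (simp add: arcs_ends_induce_with_proj)
  with ccr show ?thesis
    by (intro that[of u w]) (auto simp: arcs_ends_induce_with_proj)
qed

text \<open>By symmetry an arc inside \<open>A\<close> comes with its reverse, so its two ends reach
  each other.\<close>

lemma (in pair_sym_digraph) sccs_verts_induce_closed:
  assumes "W \<in> pre_digraph.sccs_verts (with_proj G \<restriction> A)" "u \<in> W" "(u, v) \<in> parcs G"
    and "u \<in> A" "v \<in> A"
  shows "v \<in> W"
proof -
  interpret A: wf_digraph "with_proj G \<restriction> A" by (rule wellformed_induce_subgraph)
  have "(v, u) \<in> parcs G" using assms(3) arcs_symmetric by simp
  then have "u \<rightarrow>\<^sup>*\<^bsub>with_proj G \<restriction> A\<^esub> v" "v \<rightarrow>\<^sup>*\<^bsub>with_proj G \<restriction> A\<^esub> u"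
    using assms(3-5) by (auto simp: arcs_ends_induce_with_proj)
  then show ?thesis
    using assms(1,2) unfolding A.in_sccs_verts_conv_reachable by blast
qed

lemma (in pair_wf_digraph) sccs_verts_induce_subset:
  assumes "W \<in> pre_digraph.sccs_verts (with_proj G \<restriction> A)"
  shows "W \<subseteq> A"
  using wf_digraph.sccs_verts_subsets[OF wellformed_induce_subgraph assms] by simp

lemma (in pair_wf_digraph) sccs_verts_induce_disjoint:
  assumes "W \<in> pre_digraph.sccs_verts (with_proj G \<restriction> A)"
    and "W' \<in> pre_digraph.sccs_verts (with_proj G \<restriction> A)"
    and "u \<in> W" "u \<in> W'"
  shows "W = W'"
  using wf_digraph.sccs_verts_disjoint[OF wellformed_induce_subgraph assms(1,2)] assms(3,4) by auto

lemma zq_win_tokens: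
  assumes "finite A" "A \<subseteq> verts G" "A \<inter> B = {}" "zq_win q G t (A \<union> B)"
  shows "zq_win q G (card A + t) B"
  using assms
proof (induction A arbitrary: B rule: finite_induct)
  case (insert a A)
  have "zq_win q G (card A + t) (insert a B)"
    using insert.hyps insert.prems by (intro insert.IH) auto
  then show ?case
    using zq_win.token[of a G B q "card A + t"] insert.hyps insert.prems by simp
qed simp

section \<open>The book graph in coordinates: centre \<open>c\<close>, leaves \<open>L\<close>,
  layers \<open>x\<close> and \<open>y\<close>\<close>

locale book_graph =
  fixes G :: "('a \<times> 'b) pair_pre_digraph" and c :: 'a and L :: "'a set" and x y :: 'b
  assumes c_notin: "c \<notin> L" and fin: "finite L" and x_neq_y: "x \<noteq> y"
    and pverts_eq: "pverts G = insert c L \<times> {x, y}"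
    and arc_iff: "((u, s), (v, t)) \<in> parcs G \<longleftrightarrow>
      u \<in> insert c L \<and> v \<in> insert c L \<and> s \<in> {x, y} \<and> t \<in> {x, y} \<and>
      (u = v \<and> s \<noteq> t \<or> s = t \<and> (u = c) \<noteq> (v = c))"
begin

lemma pair_graph_G: "pair_graph G"
proof
  have "(u, s) \<in> pverts G \<and> (v, t) \<in> pverts G" if "((u, s), (v, t)) \<in> parcs G" for u s v t
    using that unfolding arc_iff pverts_eq by blast
  then have sub: "parcs G \<subseteq> pverts G \<times> pverts G" by auto
  show fv: "finite (pverts G)" by (simp add: pverts_eq fin)
  show "finite (parcs G)" using finite_subset[OF sub] fv by simp
  have "((v, t), (u, s)) \<in> parcs G" if "((u, s), (v, t)) \<in> parcs G" for u s v t
    using that unfolding arc_iff by blast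
  then show "symmetric G" unfolding symmetric_def by (simp add: sym_def)
  fix e assume e: "e \<in> parcs G"
  then show "fst e \<in> pverts G" "snd e \<in> pverts G" using sub by auto
  have "(u, s) \<noteq> (v, t)" if "((u, s), (v, t)) \<in> parcs G" for u s v t
    using that unfolding arc_iff by blast
  then show "fst e \<noteq> snd e" using e by (metis prod.collapse)
qed

sublocale pair_graph G by (rule pair_graph_G)

lemma nbrs:
  "((c, x), v) \<in> parcs G \<longleftrightarrow> v = (c, y) \<or> v \<in> L \<times> {x}"
  "((c, y), v) \<in> parcs G \<longleftrightarrow> v = (c, x) \<or> v \<in> L \<times> {y}"
  "l \<in> L \<Longrightarrow> ((l, x), v) \<in> parcs G \<longleftrightarrow> v = (l, y) \<or> v = (c, x)"
  "l \<in> L \<Longrightarrow> ((l, y), v) \<in> parcs G \<longleftrightarrow> v = (l, x) \<or> v = (c, y)"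
proof -
  obtain k t where v: "v = (k, t)" by fastforce
  show "((c, x), v) \<in> parcs G \<longleftrightarrow> v = (c, y) \<or> v \<in> L \<times> {x}"
    "((c, y), v) \<in> parcs G \<longleftrightarrow> v = (c, x) \<or> v \<in> L \<times> {y}"
    unfolding v arc_iff using x_neq_y c_notin by blast+
  assume "l \<in> L"
  then show "((l, x), v) \<in> parcs G \<longleftrightarrow> v = (l, y) \<or> v = (c, x)"
    "((l, y), v) \<in> parcs G \<longleftrightarrow> v = (l, x) \<or> v = (c, y)"
    unfolding v arc_iff using x_neq_y c_notin by blast+
qed

section \<open>The potential and the lower bound for positive \<open>q\<close>\<close>

definition untouched :: "('a \<times> 'b) set \<Rightarrow> 'a set" where
  "untouched B = {l \<in> L. {l} \<times> {x, y} \<inter> B = {}}"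

text \<open>Both kinds of free move depend on this: where it fails, nothing can be forced on
  \<open>G\<close> and the uncoloured vertices form one component.\<close>

definition opened :: "('a \<times> 'b) set \<Rightarrow> bool" where
  "opened B \<longleftrightarrow> (c, x) \<in> B \<or> (c, y) \<in> B \<or> (\<exists>l \<in> L. {l} \<times> {x, y} \<subseteq> B)"

text \<open>Truncated subtraction gives the value 0 once no page is untouched.\<close>

definition cost :: "('a \<times> 'b) set \<Rightarrow> nat" where
  "cost B = card (untouched B) - (if opened B then 1 else 0)"

lemma finite_untouched: "finite (untouched B)"
  using fin by (simp add: untouched_def)

lemma opened_mono: "B \<subseteq> B' \<Longrightarrow> opened B \<Longrightarrow> opened B'"
  unfolding opened_def by blast

lemma untouched_insert: "untouched (insert (l, t) B) = untouched B - (if t \<in> {x, y} then {l} else {})"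
  unfolding untouched_def by auto

text \<open>A vertex on an untouched page lowers only the count, and any other vertex can at most
  trigger the discount, so the two losses never coincide.\<close>

lemma cost_token: "cost B \<le> Suc (cost (insert v B))"
proof (cases v)
  case (Pair l t)
  show ?thesis
  proof (cases "l \<in> untouched B \<and> t \<in> {x, y}")
    case True
    \<comment> \<open>The mate of the new vertex on page \<open>l\<close> stays uncoloured, so no
      page is completed.\<close>
    then have "opened (insert v B) \<longleftrightarrow> opened B"
      using c_notin x_neq_y unfolding Pair opened_def untouched_def by auto
    moreover have "card (untouched B) = Suc (card (untouched (insert v B)))"
      using True finite_untouched[of B] card_Suc_Diff1[of "untouched B" l]
      unfolding Pair untouched_insert by simp
    ultimately show ?thesis unfolding cost_def by simp
  next
    case False
    then have "untouched (insert v B) = untouched B"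
      unfolding Pair untouched_insert by auto
    then show ?thesis unfolding cost_def by auto
  qed
qed

text \<open>The first vertex coloured on an untouched page can only be forced by the centre of its
  layer, and that centre sees every untouched page whose vertex in this layer belongs to
  \<open>H\<close>.\<close>

lemma ccr_untouched:
  assumes "ccr (with_proj G \<restriction> H) B B'"
  shows "untouched B' = untouched B \<or>
    (\<exists>l. \<exists>t\<in>{x, y}. {k \<in> untouched B. (k, t) \<in> H} = {l})"
proof -
  obtain u w where uw: "u \<in> B" "(u, w) \<in> parcs G" "u \<in> H" "w \<in> H" "w \<notin> B" "B' = insert w B"
    and uniq: "\<forall>v. (u, v) \<in> parcs G \<longrightarrow> v \<in> H \<longrightarrow> v \<notin> B \<longrightarrow> v = w"
    using assms by (elim ccr_induceE) blast
  obtain k s l t where kslt: "u = (k, s)" "w = (l, t)" by fastforce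
  show ?thesis
  proof (cases "l \<in> untouched B \<and> t \<in> {x, y}")
    case True
    then have "k = c" "s = t"
      using uw c_notin unfolding kslt untouched_def by (auto simp: arc_iff)
    then have "k' = l" if "k' \<in> untouched B" "(k', t) \<in> H" for k'
      using uniq[rule_format, of "(k', t)"] that True c_notin
      unfolding kslt untouched_def by (auto simp: arc_iff)
    then have "{k \<in> untouched B. (k, t) \<in> H} = {l}"
      using True uw(4) unfolding kslt by auto
    then show ?thesis using True by blast
  next
    case False
    then show ?thesis unfolding uw(6) kslt untouched_insert by auto
  qed
qed

text \<open>A page vertex has just two neighbours, so when it forces, one of them is coloured
  already: either its mate, which makes the page whole, or a centre.\<close>

lemma ccr_imp_opened:
  assumes "ccr (with_proj G) B B'"
  shows "opened B"
proof -
  have "ccr (with_proj G \<restriction> pverts G) B B'"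
    using assms by (simp add: with_proj_induce_pverts[OF pair_wf_digraph])
  then obtain u w where uw: "u \<in> B" "(u, w) \<in> parcs G" "u \<in> pverts G" "w \<in> pverts G" "w \<notin> B"
      "B' = insert w B"
    and uniq: "\<forall>v. (u, v) \<in> parcs G \<longrightarrow> v \<in> pverts G \<longrightarrow> v \<notin> B \<longrightarrow> v = w"
    by (elim ccr_induceE) blast
  obtain k s where ks: "u = (k, s)" by fastforce
  have "k \<in> insert c L" "s \<in> {x, y}" using uw(2) unfolding ks by (cases w, auto simp: arc_iff)+
  then consider "k = c" | s' where "k \<in> L" "{s, s'} = {x, y}" "s \<noteq> s'" "k \<noteq> c"
    using c_notin x_neq_y by blast
  then show ?thesis
  proof cases
    case 1
    then show ?thesis using uw(1) \<open>s \<in> {x, y}\<close> unfolding ks opened_def by auto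
  next
    case 2
    have "(u, (k, s')) \<in> parcs G" "(u, (c, s)) \<in> parcs G" "(k, s') \<noteq> (c, s)"
      using 2 unfolding ks by (auto simp: arc_iff)
    then have "(k, s') \<in> B \<or> (c, s) \<in> B"
      using uniq in_arcsD2 by metis
    then show ?thesis
      using 2 uw(1) \<open>s \<in> {x, y}\<close> unfolding ks opened_def by auto
  qed
qed

text \<open>The discount is already granted when a force happens, and the count can change only if
  at most one untouched page is left, when the cost is already 0.\<close>

lemma cost_force:
  assumes "ccr (with_proj G) B B'"
  shows "cost B \<le> cost B'"
proof -
  have H: "ccr (with_proj G \<restriction> pverts G) B B'"
    using assms by (simp add: with_proj_induce_pverts[OF pair_wf_digraph])
  have op: "opened B" using assms by (rule ccr_imp_opened)
  moreover have "opened B'"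
    using opened_mono[OF _ op] assms by (metis ccr.cases subset_insertI)
  moreover have "untouched B' = untouched B \<or> card (untouched B) \<le> 1"
  proof -
    \<comment> \<open>On the whole graph every untouched page is visible, so the exceptional case of
      \<open>ccr_untouched\<close> makes \<open>untouched B\<close> a singleton.\<close>
    have "{k \<in> untouched B. (k, t) \<in> pverts G} = untouched B" if "t \<in> {x, y}" for t
      using that unfolding untouched_def pverts_eq by auto
    then show ?thesis using ccr_untouched[OF H] by force
  qed
  ultimately show ?thesis unfolding cost_def by auto
qed

text \<open>The hypothesis depends on the position only through its untouched pages, and it prevents
  a step from changing these, so it persists.\<close>

lemma ccr_rtranclp_untouched:
  assumes "(ccr (with_proj G \<restriction> H))\<^sup>*\<^sup>* B B'"
    and "\<forall>t \<in> {x, y}. \<forall>l. {k \<in> untouched B. (k, t) \<in> H} \<noteq> {l}"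
  shows "untouched B' = untouched B \<and> B \<subseteq> B'"
  using assms(1)
proof (induction rule: rtranclp_induct)
  case (step B' B'')
  have "untouched B'' = untouched B'"
    using ccr_untouched[OF step.hyps(2)] step.IH assms(2) by metis
  moreover have "B' \<subseteq> B''" using step.hyps(2) by (auto elim: ccr.cases)
  ultimately show ?case using step.IH by auto
qed auto

text \<open>Both centres are uncoloured and adjacent, and every other vertex is adjacent to one of
  them. A vertex common to all components leaves room for only one.\<close>

lemma sccs_verts_unopened:
  assumes "\<not> opened B" "W \<in> pre_digraph.sccs_verts (with_proj G \<restriction> (pverts G - B))"
  shows "(c, x) \<in> W"
proof -
  let ?A = "pverts G - B"
  note closed = sccs_verts_induce_closed[OF assms(2)]
  have cx: "(c, x) \<in> ?A" "(c, y) \<in> ?A"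
    using assms(1) unfolding opened_def pverts_eq by auto
  have "W \<noteq> {}" "W \<subseteq> ?A"
    using assms(2) sccs_verts_induce_subset[OF assms(2)] by (auto simp: pre_digraph.sccs_verts_def)
  then obtain k s where ks: "(k, s) \<in> W" "(k, s) \<in> ?A" by auto
  have s: "s \<in> {x, y}" "k \<in> insert c L" using ks unfolding pverts_eq by auto
  have "(c, s) \<in> W"
  proof (cases "k = c")
    case False
    then have "((k, s), (c, s)) \<in> parcs G" using s by (auto simp: arc_iff)
    then show ?thesis using closed ks cx s(1) by auto
  qed (use ks in simp)
  then show ?thesis
    using closed[of "(c, y)" "(c, x)"] cx s(1) x_neq_y by (auto simp: arc_iff)
qed

text \<open>The answer is built to exclude the only situation in which \<open>ccr_untouched\<close>
  lets an untouched page be reached.\<close>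

lemma announce_response:
  assumes "S \<subseteq> pre_digraph.sccs_verts (with_proj G \<restriction> (pverts G - B))" "2 \<le> card S"
  obtains R where "R \<subseteq> S" "R \<noteq> {}"
    "\<forall>t \<in> {x, y}. \<forall>l. {k \<in> untouched B. (k, t) \<in> B \<union> \<Union>R} \<noteq> {l}"
proof -
  \<comment> \<open>Both vertices of an untouched page are uncoloured and adjacent, so a component
    contains both or neither.\<close>
  have page: "(k, t) \<in> W \<Longrightarrow> (k, t') \<in> W"
    if "W \<in> S" "k \<in> untouched B" "t \<in> {x, y}" "t' \<in> {x, y}" for k t t' W
    using sccs_verts_induce_closed[of W "pverts G - B" "(k, t)" "(k, t')"] that assms(1)
    by (cases "t = t'") (auto simp: arc_iff untouched_def pverts_eq)
  \<comment> \<open>The untouched pages visible after the answer \<open>R\<close>; by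
    \<open>page\<close>, layer \<open>x\<close> speaks for both layers.\<close>
  define P where "P R = {k \<in> untouched B. (k, x) \<in> \<Union>R}" for R
  have P: "{k \<in> untouched B. (k, t) \<in> B \<union> \<Union>R} = P R" if "R \<subseteq> S" "t \<in> {x, y}" for R t
  proof -
    have "(k, t) \<in> B \<union> \<Union>R \<longleftrightarrow> (k, x) \<in> \<Union>R" if "k \<in> untouched B" for k
    proof -
      have "(k, t) \<notin> B" using \<open>t \<in> _\<close> that by (auto simp: untouched_def)
      then show ?thesis using page that \<open>t \<in> _\<close> \<open>R \<subseteq> S\<close> by blast
    qed
    then show ?thesis unfolding P_def by blast
  qed
  show ?thesis
  proof (cases "\<exists>l. P S = {l}")
    case False
    then show ?thesis using that[of S] P[of S] assms(2) by fastforce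
  next
    case True
    then obtain l W where l: "P S = {l}" and W: "W \<in> S" "(l, x) \<in> W"
      unfolding P_def by blast
    \<comment> \<open>Withholding the component of the single visible page leaves none
      visible.\<close>
    let ?R = "S - {W}"
    have "P ?R = {}"
    proof (rule ccontr)
      assume "P ?R \<noteq> {}"
      moreover have "P ?R \<subseteq> P S" unfolding P_def by blast
      ultimately obtain W' where "W' \<in> ?R" "(l, x) \<in> W'" unfolding l unfolding P_def by blast
      then show False
        using sccs_verts_induce_disjoint[of W "pverts G - B" W'] W assms(1) by blast
    qed
    \<comment> \<open>This is where q \<ge> 1 enters: at least two components are announced, so one
      remains to be returned.\<close>
    moreover have "?R \<noteq> {}"
    proof
      assume "?R = {}"
      then have "S \<subseteq> {W}" by auto
      then show False using assms(2) card_mono[of "{W}" S] by simp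
    qed
    ultimately show ?thesis using P[of ?R] by (intro that[of ?R]) (blast+)
  qed
qed

lemma cost_le_tokens:
  assumes "zq_win q (with_proj G) t B" "q \<ge> 1"
  shows "cost B \<le> t"
  using assms(1)
proof induction
  case (finished t)
  have "untouched (verts (with_proj G)) = {}" unfolding untouched_def by (auto simp: pverts_eq)
  then show ?case unfolding cost_def by simp
next
  case (token v B t)
  then show ?case using cost_token[of B v] by simp
next
  case (force B B' t)
  then show ?case using cost_force by fastforce
next
  case (announce S B t)
  have S: "S \<subseteq> pre_digraph.sccs_verts (with_proj G \<restriction> (pverts G - B))" "2 \<le> card S"
    using announce.hyps assms(2) by auto
  \<comment> \<open>Otherwise all components share \<open>(c, x)\<close> and coincide, but two were
    announced.\<close>
  have op: "opened B"
  proof (rule ccontr)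
    assume n: "\<not> opened B"
    have "W = W'" if "W \<in> S" "W' \<in> S" for W W'
      using sccs_verts_unopened[OF n] sccs_verts_induce_disjoint that S(1) by blast
    then have "card S \<le> 1"
      by (metis One_nat_def card.infinite card_le_Suc0_iff_eq zero_le)
    then show False using S(2) by simp
  qed
  obtain R where R: "R \<subseteq> S" "R \<noteq> {}"
    and U: "\<forall>t \<in> {x, y}. \<forall>l. {k \<in> untouched B. (k, t) \<in> B \<union> \<Union>R} \<noteq> {l}"
    using announce_response[OF S] by blast
  obtain B' where B': "(ccr (with_proj G \<restriction> (B \<union> \<Union>R)))\<^sup>*\<^sup>* B B'" "cost B' \<le> t"
    using announce.IH[OF R] by auto
  \<comment> \<open>Neither ingredient of the cost changes under this answer.\<close>
  have "untouched B' = untouched B" "opened B'"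
    using ccr_rtranclp_untouched[OF B'(1) U] opened_mono[OF _ op] by auto
  then show ?case using B'(2) op unfolding cost_def by simp
qed

section \<open>The lower bound of two tokens for every \<open>q\<close>\<close>

lemma four_cycle:
  assumes "(v, w) \<in> parcs G"
  assumes "L \<noteq> {}"
  obtains w' z where "(w, z) \<in> parcs G" "(z, w') \<in> parcs G" "(v, w') \<in> parcs G"
    "z \<noteq> v" "w' \<noteq> w"
proof -
  obtain k s l t where vw: "v = (k, s)" "w = (l, t)" by fastforce
  obtain m where m: "m \<in> L" using assms(2) by auto
  have st: "s \<in> {x, y}" "t \<in> {x, y}" "k \<in> insert c L" "l \<in> insert c L"
    using assms(1) unfolding vw arc_iff by blast+
  show ?thesis
  proof (cases "k = l")
    case True
    \<comment> \<open>For an edge between the layers, a neighbour \<open>m'\<close> of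
      \<open>k\<close> in the star supplies the parallel edge.\<close>
    define m' where "m' = (if k = c then m else c)"
    have "(w, (m', t)) \<in> parcs G" "((m', t), (m', s)) \<in> parcs G" "(v, (m', s)) \<in> parcs G"
      "(m', t) \<noteq> v" "(m', s) \<noteq> w"
      using True assms(1) st m c_notin unfolding vw m'_def by (auto simp: arc_iff)
    then show ?thesis by (rule that)
  next
    case False
    \<comment> \<open>An edge inside a layer is paired with its copy in the other layer.\<close>
    obtain s' where s': "s' \<in> {x, y}" "s' \<noteq> s" using x_neq_y st by auto
    have "(w, (l, s')) \<in> parcs G" "((l, s'), (k, s')) \<in> parcs G" "(v, (k, s')) \<in> parcs G"
      "(l, s') \<noteq> v" "(k, s') \<noteq> w"
      using False assms(1) st s' c_notin unfolding vw by (auto simp: arc_iff)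
    then show ?thesis by (rule that)
  qed
qed

text \<open>If a lone coloured \<open>v\<close> forced \<open>w\<close>, a 4-cycle through both
  would lead from \<open>w\<close> along uncoloured vertices to another neighbour of
  \<open>v\<close>; this lies in the component of \<open>w\<close>, so \<open>v\<close> would see
  two uncoloured vertices.\<close>

lemma two_le_card_if_ccr:
  assumes "ccr (with_proj G \<restriction> (B \<union> \<Union>R)) B B'"
    and R: "R \<subseteq> pre_digraph.sccs_verts (with_proj G \<restriction> (pverts G - B))"
    and "L \<noteq> {}" "finite B"
  shows "2 \<le> card B"
proof (rule ccontr)
  assume small: "\<not> 2 \<le> card B"
  obtain v w where vw: "v \<in> B" "(v, w) \<in> parcs G" "v \<in> B \<union> \<Union>R" "w \<in> B \<union> \<Union>R" "w \<notin> B"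
      "B' = insert w B"
    and uniq: "\<forall>z. (v, z) \<in> parcs G \<longrightarrow> z \<in> B \<union> \<Union>R \<longrightarrow> z \<notin> B \<longrightarrow> z = w"
    using assms(1) by (elim ccr_induceE) blast
  have B: "B = {v}"
    using small vw(1) \<open>finite B\<close> card_le_Suc0_iff_eq[of B] by force
  obtain w' z where c: "(w, z) \<in> parcs G" "(z, w') \<in> parcs G" "(v, w') \<in> parcs G"
    "z \<noteq> v" "w' \<noteq> w"
    using four_cycle[OF vw(2) assms(3)] by blast
  have "w' \<noteq> v" using c(3) no_loops' by blast
  obtain W where W: "W \<in> R" "w \<in> W" using vw by auto
  have V: "w \<in> pverts G - B" "z \<in> pverts G - B" "w' \<in> pverts G - B"
    using vw c \<open>w' \<noteq> v\<close> in_arcsD2 unfolding B by auto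
  have "z \<in> W" using sccs_verts_induce_closed[OF _ W(2) c(1)] V W(1) R by auto
  then have "w' \<in> W" using sccs_verts_induce_closed[OF _ _ c(2)] V W(1) R by auto
  then show False using uniq[rule_format, OF c(3)] c(5) W(1) V by auto
qed

text \<open>A token preserves the sum, and a free move that changes \<open>B\<close> requires two
  coloured vertices beforehand.\<close>

lemma two_le_tokens:
  assumes "zq_win q (with_proj G) t B" "L \<noteq> {}" "finite B" "B \<subseteq> pverts G"
  shows "2 \<le> card B + t"
  using assms(1,3,4)
proof induction
  case (finished t)
  have "{(c, x), (c, y)} \<subseteq> pverts G" unfolding pverts_eq by auto
  from card_mono[OF _ this] show ?case using x_neq_y pair_finite_verts by simp
next
  case (token v B t)
  then show ?case by auto
next
  case (force B B' t)
  \<comment> \<open>The rule on \<open>G\<close> is treated as an answer that returns all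
    components.\<close>
  let ?R = "pre_digraph.sccs_verts (with_proj G \<restriction> (pverts G - B))"
  interpret A: wf_digraph "with_proj G \<restriction> (pverts G - B)" by (rule wellformed_induce_subgraph)
  have "pverts G - B \<subseteq> \<Union>?R"
    using A.scc_of_in_sccs_verts A.in_scc_of_self by fastforce
  moreover have "\<Union>?R \<subseteq> pverts G - B" using sccs_verts_induce_subset by blast
  ultimately have "B \<union> \<Union>?R = pverts G" using force.prems by blast
  then have "2 \<le> card B"
    using two_le_card_if_ccr[of B ?R B'] force.hyps force.prems assms(2)
    by (simp add: with_proj_induce_pverts[OF pair_wf_digraph])
  then show ?case by simp
next
  case (announce S B t)
  \<comment> \<open>The oracle returns all of \<open>S\<close>, which is legal since
    \<open>S\<close> is nonempty.\<close>
  have "S \<noteq> {}" using announce.hyps by auto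
  then obtain B' where B': "(ccr (with_proj G \<restriction> (B \<union> \<Union>S)))\<^sup>*\<^sup>* B B'"
    "finite B' \<Longrightarrow> B' \<subseteq> pverts G \<Longrightarrow> 2 \<le> card B' + t"
    using announce.IH[of S] by auto
  show ?case
  proof (cases "B' = B")
    case True
    then show ?thesis using B' announce.prems by auto
  next
    case False
    then obtain B'' where "ccr (with_proj G \<restriction> (B \<union> \<Union>S)) B B''"
      using B'(1) by (auto elim: converse_rtranclpE)
    then show ?thesis
      using two_le_card_if_ccr[of B S B''] announce.hyps announce.prems assms(2) by simp
  qed
qed

section \<open>A strategy with \<open>card L\<close> tokens\<close>

lemma zq_win_forceI:
  assumes "zq_win q (with_proj G) t (insert w B)"
    and "u \<in> B" "(u, w) \<in> parcs G" "\<And>v. (u, v) \<in> parcs G \<Longrightarrow> v \<notin> B \<Longrightarrow> v = w"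
  shows "zq_win q (with_proj G) t B"
proof (cases "w \<in> B")
  case True
  then show ?thesis using assms(1) by (simp add: insert_absorb)
next
  case False
  show ?thesis
    by (rule zq_win.force[OF ccr_with_projI[OF assms(2,3) False assms(4)] assms(1)])
qed

text \<open>With the centre of layer \<open>x\<close> coloured, the mate \<open>(l, y)\<close> is
  the only neighbour of \<open>(l, x)\<close> that can be uncoloured, so each page of
  \<open>M\<close> completes itself.\<close>

lemma zq_win_force_pages:
  assumes "finite M" "M \<subseteq> L" "(c, x) \<in> B" "M \<times> {x} \<subseteq> B"
    and "zq_win q (with_proj G) t (M \<times> {y} \<union> B)"
  shows "zq_win q (with_proj G) t B"
  using assms
proof (induction M arbitrary: B rule: finite_induct)
  case (insert l M)
  have "insert l M \<times> {y} \<union> B = M \<times> {y} \<union> insert (l, y) B" by auto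
  then have "zq_win q (with_proj G) t (M \<times> {y} \<union> insert (l, y) B)"
    using insert.prems(4) by simp
  then have "zq_win q (with_proj G) t (insert (l, y) B)"
    by (rule insert.IH[rotated -1]) (use insert.prems(1-3) in auto)
  moreover have "v = (l, y)" if "((l, x), v) \<in> parcs G" "v \<notin> B" for v
    using that insert.prems(1,2) by (auto simp: nbrs)
  moreover have "(l, x) \<in> B" "((l, x), (l, y)) \<in> parcs G"
    using insert.prems(1,3) by (auto simp: nbrs)
  ultimately show ?case
    using zq_win_forceI[of q t "(l, y)" B "(l, x)"] by blast
qed simp

text \<open>Tokens go to \<open>(c, x)\<close> and to the \<open>x\<close> vertices of all pages but
  \<open>l\<close>. These pages complete themselves; then \<open>(m, y)\<close> forces
  \<open>(c, y)\<close>, \<open>(c, x)\<close> forces \<open>(l, x)\<close>, and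
  \<open>(l, x)\<close> forces \<open>(l, y)\<close>.\<close>

lemma zq_win_card_pages:
  assumes "2 \<le> card L"
  shows "zq_win q (with_proj G) (card L) {}"
proof -
  obtain l where l: "l \<in> L" using assms by fastforce
  define M where "M = L - {l}"
  have card_M: "card L = Suc (card M)" "finite M"
    using l fin card_Suc_Diff1[of L l] unfolding M_def by auto
  \<comment> \<open>A page other than \<open>l\<close> is needed to force the second centre.\<close>
  then obtain m where m: "m \<in> M" using assms by fastforce
  have mL: "m \<in> L" "m \<noteq> c" "l \<noteq> c" using m l c_notin unfolding M_def by auto
  define A where "A = insert (c, x) (M \<times> {x})"
  define A1 where "A1 = M \<times> {y} \<union> A"
  define A2 where "A2 = insert (c, y) A1"
  define A3 where "A3 = insert (l, x) A2"
  have L: "L = insert l M" using l unfolding M_def by auto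
  have "insert (l, y) A3 = pverts G"
    unfolding A3_def A2_def A1_def A_def pverts_eq L by auto
  \<comment> \<open>The forces are retraced backwards from the finished position.\<close>
  then have "zq_win q (with_proj G) 0 (insert (l, y) A3)"
    using zq_win.finished[of q "with_proj G" 0] by simp
  then have "zq_win q (with_proj G) 0 A3"
    by (rule zq_win_forceI[where u = "(l, x)"])
      (use mL l x_neq_y in \<open>auto simp: nbrs A3_def A2_def A1_def A_def\<close>)
  then have "zq_win q (with_proj G) 0 A2"
    unfolding A3_def
    by (rule zq_win_forceI[where u = "(c, x)"])
      (use l c_notin x_neq_y in \<open>auto simp: nbrs A2_def A1_def A_def L\<close>)
  then have "zq_win q (with_proj G) 0 A1"
    unfolding A2_def
    by (rule zq_win_forceI[where u = "(m, y)"])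
      (use m mL x_neq_y in \<open>auto simp: nbrs A1_def A_def\<close>)
  then have "zq_win q (with_proj G) 0 A"
    unfolding A1_def
    by (rule zq_win_force_pages[rotated -1]) (use card_M in \<open>auto simp: A_def L\<close>)
  moreover have "card A = card L"
    using card_M c_notin unfolding A_def L by (auto simp: card_insert_if card_cartesian_product)
  ultimately show ?thesis
    using zq_win_tokens[of A "with_proj G" "{}" q 0] card_M(2)
    by (auto simp: A_def pverts_eq L)
qed

section \<open>A strategy with two tokens for \<open>q = 0\<close>\<close>

lemma page_in_sccs_verts:
  assumes "M \<subseteq> L" "l \<in> L - M"
  shows "{l} \<times> {x, y} \<in> pre_digraph.sccs_verts (with_proj G \<restriction> (pverts G - insert c M \<times> {x, y}))"
    (is "?W \<in> pre_digraph.sccs_verts ?H")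
proof -
  interpret H: wf_digraph ?H by (rule wellformed_induce_subgraph)
  have adj: "((l, x), (l, y)) \<in> arcs_ends ?H" "((l, y), (l, x)) \<in> arcs_ends ?H"
    using assms c_notin by (auto simp: arcs_ends_induce_with_proj nbrs pverts_eq)
  have inH: "(l, x) \<in> verts ?H" "(l, y) \<in> verts ?H"
    using assms c_notin by (auto simp: pverts_eq)
  \<comment> \<open>The only neighbours of a page outside it are the two centres, which are deleted
    here.\<close>
  have closed: "v \<in> ?W" if "u \<rightarrow>\<^sup>*\<^bsub>?H\<^esub> v" "u \<in> ?W" for u v
    using that
  proof (induction rule: H.reachable_induct)
    case (step v w)
    then have "v = (l, x) \<or> v = (l, y)" by blast
    moreover have "(v, w) \<in> parcs G" "w \<notin> insert c M \<times> {x, y}"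
      using step.hyps(2) unfolding arcs_ends_induce_with_proj by blast+
    ultimately show ?case using assms(2) nbrs(3,4)[of l w] by blast
  qed simp
  have reach: "u \<rightarrow>\<^sup>*\<^bsub>?H\<^esub> v" if "u \<in> ?W" "v \<in> ?W" for u v
  proof -
    have "(l, x) \<rightarrow>\<^sup>*\<^bsub>?H\<^esub> (l, x)" "(l, y) \<rightarrow>\<^sup>*\<^bsub>?H\<^esub> (l, y)"
      using inH H.reachable_refl by blast+
    then show ?thesis using that H.reachable_adjI[OF adj(1)] H.reachable_adjI[OF adj(2)] by blast
  qed
  show ?thesis
    unfolding H.in_sccs_verts_conv_reachable
  proof (intro conjI ballI allI impI)
    fix u v assume "u \<in> ?W" "v \<notin> ?W"
    then show "\<not> u \<rightarrow>\<^sup>*\<^bsub>?H\<^esub> v \<or> \<not> v \<rightarrow>\<^sup>*\<^bsub>?H\<^esub> u" using closed[of u v] by metis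
  qed (simp, rule reach)
qed

text \<open>For \<open>q = 0\<close> a single page may be announced, which leaves the oracle no
  choice; so the remaining pages are coloured one by one at no cost.\<close>

lemma zq_win_0_centres:
  assumes "M \<subseteq> L"
  shows "zq_win 0 (with_proj G) t (insert c M \<times> {x, y})"
  using assms
proof (induction "card (L - M)" arbitrary: M)
  case 0
  then have "M = L" using fin by auto
  then show ?case using zq_win.finished[of 0 "with_proj G" t] by (simp add: pverts_eq)
next
  case (Suc k)
  then obtain l where l: "l \<in> L - M" by (metis card.empty equals0I nat.distinct(1))
  let ?B = "insert c M \<times> {x, y}" and ?W = "{l} \<times> {x, y}"
  let ?H = "?B \<union> ?W"
  have "L - insert l M = L - M - {l}" by auto
  then have "k = card (L - insert l M)" using Suc.hyps(2) l fin by simp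
  then have win: "zq_win 0 (with_proj G) t (insert c (insert l M) \<times> {x, y})"
    using Suc.hyps(1) Suc.prems l by blast
  \<comment> \<open>Page \<open>l\<close> is the only uncoloured part of \<open>?H\<close>, so each
    centre has a unique uncoloured neighbour there.\<close>
  have "ccr (with_proj G \<restriction> ?H) ?B (insert (l, x) ?B)"
    using l c_notin x_neq_y by (intro ccr_induceI[of "(c, x)"]) (auto simp: nbrs)
  moreover have "ccr (with_proj G \<restriction> ?H) (insert (l, x) ?B) (insert (l, y) (insert (l, x) ?B))"
    using l c_notin x_neq_y by (intro ccr_induceI[of "(c, y)"]) (auto simp: nbrs)
  ultimately have "(ccr (with_proj G \<restriction> ?H))\<^sup>*\<^sup>* ?B (insert (l, y) (insert (l, x) ?B))"
    by (meson converse_rtranclp_into_rtranclp r_into_rtranclp)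
  moreover have "insert (l, y) (insert (l, x) ?B) = insert c (insert l M) \<times> {x, y}" by auto
  ultimately have steps: "(ccr (with_proj G \<restriction> ?H))\<^sup>*\<^sup>* ?B (insert c (insert l M) \<times> {x, y})" by simp
  show ?case
  proof (rule zq_win.announce[of "{?W}"])
    show "{?W} \<subseteq> pre_digraph.sccs_verts (with_proj G \<restriction> (verts (with_proj G) - ?B))"
      using page_in_sccs_verts[OF Suc.prems l] by simp
  next
    fix R assume "R \<subseteq> {?W}" "R \<noteq> {}"
    then have "R = {?W}" by auto
    then show "\<exists>B'. (ccr (with_proj G \<restriction> (?B \<union> \<Union>R)))\<^sup>*\<^sup>* ?B B' \<and> zq_win 0 (with_proj G) t B'"
      using steps win by auto
  qed simp
qed

section \<open>The values of \<open>Zq\<close>\<close>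

lemma Zq_0: "L \<noteq> {} \<Longrightarrow> Zq 0 (with_proj G) = 2"
proof (unfold Zq_def, rule Least_equality)
  have "zq_win 0 (with_proj G) (card ({c} \<times> {x, y}) + 0) {}"
    using zq_win_0_centres[of "{}" 0] by (intro zq_win_tokens) (auto simp: pverts_eq)
  then show "zq_win 0 (with_proj G) 2 {}" using x_neq_y by (simp add: card_cartesian_product numeral_2_eq_2)
qed (use two_le_tokens[of 0 _ "{}"] in auto)

lemma Zq_pos: "2 \<le> card L \<Longrightarrow> 1 \<le> q \<Longrightarrow> Zq q (with_proj G) = card L"
proof (unfold Zq_def, rule Least_equality)
  fix t assume "1 \<le> q" "zq_win q (with_proj G) t {}"
  moreover have "cost {} = card L" unfolding cost_def untouched_def opened_def by simp
  ultimately show "card L \<le> t" using cost_le_tokens[of q t "{}"] by simp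
qed (rule zq_win_card_pages)

end

theorem theorem4p2:
  fixes S :: "'a pair_pre_digraph" and K :: "'b pair_pre_digraph" and n q :: nat
  assumes "n \<ge> 3"
    and "complete_bipartite_digraph 1 n (with_proj S)"
    and "complete_digraph 2 (with_proj K)"
  shows "Zq q (with_proj (S \<box> K)) = (if q = 0 then 2 else n)"
proof -
  obtain U L where UL: "pverts S = U \<union> L" "U \<inter> L = {}" "card U = 1" "card L = n"
    "parcs S = U \<times> L \<union> L \<times> U"
    using assms(2) unfolding complete_bipartite_digraph_pair_def by blast
  obtain c where c: "U = {c}" using UL(3) by (auto simp: card_1_singleton_iff)
  have "card (pverts K) = 2" and K: "parcs K = {(u, v). (u, v) \<in> pverts K \<times> pverts K \<and> u \<noteq> v}"
    using assms(3) unfolding complete_digraph_pair_def by auto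
  then obtain x y where xy: "pverts K = {x, y}" "x \<noteq> y" by (auto simp: card_2_iff)
  \<comment> \<open>An infinite set would have cardinality 0, whereas \<open>n\<close> is
    positive.\<close>
  have "finite L" using UL(4) assms(1) by (intro card_ge_0_finite) simp
  \<comment> \<open>The one-element side of the bipartition is the centre, the other side gives the
    leaves, and the two vertices of \<open>K\<close> index the layers.\<close>
  interpret book_graph "S \<box> K" c L x y
  proof
    show "c \<notin> L" "finite L" "x \<noteq> y" using UL(2) c xy \<open>finite L\<close> by auto
    show "pverts (S \<box> K) = insert c L \<times> {x, y}" using UL c xy by (simp add: cart_prod_def)
    show "((u, s), (v, t)) \<in> parcs (S \<box> K) \<longleftrightarrow>
      u \<in> insert c L \<and> v \<in> insert c L \<and> s \<in> {x, y} \<and> t \<in> {x, y} \<and>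
      (u = v \<and> s \<noteq> t \<or> s = t \<and> (u = c) \<noteq> (v = c))" for u s v t
      using UL(2) unfolding cart_prod_def K xy UL(1,5) c by auto
  qed
  have "L \<noteq> {}" "2 \<le> card L" using UL(4) assms(1) by auto
  then show ?thesis using Zq_0 Zq_pos[of q] UL(4) by (cases "q = 0") simp_all
qed

end
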